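(* Let $G$ and $H$ be connected graphs, each with $n$ vertices $\{1,2,\ldots,n\}$ and $m$ edges, with Laplacian matrices $L_G$ and $L_H$. Let $\tau: E(G)\to E(H)$ be a 2-isomorphism, and let $U_\tau$ be an $n\times n$ unimodular matrix such that $U_\tau L_G U_\tau^T=L_H$ and $U_\tau$ is compatible with $\tau$. Let $\mathcal{S}_G$ be a subset of $E(G)$ containing $k-1$ edges and let $\mathcal{S}_H=\tau(\mathcal{S}_G)$ be the corresponding subset of $E(H)$. Assume that the edges in $\mathcal{S}_G$ form a subtree in $G$ and that the edges in $\mathcal{S}_H$ form a subtree in $H$. Let $\mathcal{A}$ be the set of vertices spanned by the edges in $\mathcal{S}_G$ and let $\mathcal{C}$ be the set of vertices spanned by the edges in $\mathcal{S}_H$. Then $$\mathrm{Harm}(G,\mathcal{A})=\mathrm{Harm}(H,\mathcal{C})\,U_\tau,$$ where $\mathrm{Harm}(H,\mathcal{C})\,U_\tau=\{uU_\tau : u\in \mathrm{Harm}(H,\mathcal{C})\}$.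
   Context: Graphs are finite, with unweighted edges, no loops and no multiple edges; $E(G)$ denotes the edge set of $G$, and an edge with ends $a,b$ is written $(a,b)$. Vectors in $\mathbb{R}^n$ are row vectors, and $e_a$ denotes the $a$-th standard basis row vector. A unimodular matrix is a square integer matrix with determinant $\pm 1$. Laplacian: for a graph $G$ on vertices $\{1,\ldots,n\}$, $L_G$ is the $n\times n$ matrix with $(L_G)_{a,a}=d_a$ (the degree of vertex $a$) and, for $a\neq b$, $(L_G)_{a,b}=-1$ if $(a,b)\in E(G)$ and $(L_G)_{a,b}=0$ otherwise. 2-isomorphism: a bijection $\tau:E(G)\to E(H)$ is a 2-isomorphism if a subset $S\subseteq E(G)$ forms a cycle in $G$ (is the edge set of a cycle) if and only if $\tau(S)$ forms a cycle in $H$. Compatible: a unimodular matrix $U_\tau$ with $U_\tau L_G U_\tau^T=L_H$ is compatible with $\tau$ if for every edge $(a,b)\in E(G)$ one has $U_\tau(e_a-e_b)^T=(e_c-e_d)^T$ where $(c,d)=\tau(a,b)$. Here the two ends of the edge $\tau(a,b)$ are listed in a suitable order $(c,d)$; i.e. if $c,d$ are the ends of the image edge, then $U_\tau(e_a-e_b)^T$ equals $(e_c-e_d)^T$ or $(e_d-e_c)^T$. Subtree: a set of edges is a subtree if it is connected and has no cycles. The set of vertices spanned by a set of edges is the set of ends of those edges. Harmonic vectors: for $\mathcal{A}\subseteq\{1,\ldots,n\}$, let $$W(\mathcal{A})=\Big\{u=(u_1,\ldots,u_n)\in\mathbb{R}^n: u_i=0 \text{ for } i\notin\mathcal{A} \text{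 and } \sum_{i=1}^n u_i=0\Big\},$$ and $\mathrm{Harm}(G,\mathcal{A})=\{v\in\mathbb{R}^n : vL_G\in W(\mathcal{A})\}$; $\mathrm{Harm}(H,\mathcal{C})$ is defined in the same way using $L_H$. *)

theory Defs
  imports "HOL-Analysis.Analysis"
begin

(* A graph whose vertices are all elements of a finite type 'n (playing the role of {1,...,n}) is
   given by its edge set; an edge with ends a, b is the set {a, b}. *)

definition simple_graph :: "'n::finite set set \<Rightarrow> bool" where
  "simple_graph E \<longleftrightarrow> (\<forall>e\<in>E. card e = 2)"

definition adj_rel :: "'n set set \<Rightarrow> 'n rel" where
  "adj_rel E = {(a, b). {a, b} \<in> E}"

definition connected_graph :: "'n::finite set set \<Rightarrow> bool" where
  "connected_graph E \<longleftrightarrow> simple_graph E \<and> (\<forall>a b. (a, b) \<in> (adj_rel E)\<^sup>*)"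

definition degree :: "'n::finite set set \<Rightarrow> 'n \<Rightarrow> nat" where
  "degree E a = card {e \<in> E. a \<in> e}"

definition laplacian :: "'n::finite set set \<Rightarrow> real ^ 'n ^ 'n" where
  "laplacian E = (\<chi> a b. if a = b then real (degree E a) else if {a, b} \<in> E then - 1 else 0)"

definition is_cycle :: "'n set set \<Rightarrow> bool" where
  "is_cycle S \<longleftrightarrow> (\<exists>vs. distinct vs \<and> length vs \<ge> 3 \<and>
     S = {{vs ! i, vs ! (Suc i mod length vs)} | i. i < length vs})"

definition two_isomorphism ::
    "'n::finite set set \<Rightarrow> 'n set set \<Rightarrow> ('n set \<Rightarrow> 'n set) \<Rightarrow> bool" where
  "two_isomorphism E F \<tau> \<longleftrightarrow> bij_betw \<tau> E F \<and> (\<forall>S\<subseteq>E. is_cycle S \<longleftrightarrow> is_cycle (\<tau> ` S))"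

definition unimodular :: "real ^ 'n ^ 'n::finite \<Rightarrow> bool" where
  "unimodular U \<longleftrightarrow> (\<forall>i j. U $ i $ j \<in> \<int>) \<and> (det U = 1 \<or> det U = - 1)"

(* The existential quantifier chooses the order in which the two ends of the image edge
   are listed. *)
definition compatible ::
    "'n::finite set set \<Rightarrow> ('n set \<Rightarrow> 'n set) \<Rightarrow> real ^ 'n ^ 'n \<Rightarrow> bool" where
  "compatible E \<tau> U \<longleftrightarrow> (\<forall>a b. {a, b} \<in> E \<longrightarrow>
     (\<exists>c d. \<tau> {a, b} = {c, d} \<and> U *v (axis a 1 - axis b 1) = axis c 1 - axis d 1))"

(* The vertices spanned by an edge set S are those in \<Union>S; the empty edge set counts as a
   subtree. *)
definition subtree :: "'n::finite set set \<Rightarrow> bool" where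
  "subtree S \<longleftrightarrow> (\<forall>a\<in>\<Union>S. \<forall>b\<in>\<Union>S. (a, b) \<in> (adj_rel S)\<^sup>*) \<and> \<not> (\<exists>C\<subseteq>S. is_cycle C)"

definition W :: "'n::finite set \<Rightarrow> (real ^ 'n) set" where
  "W A = {u. (\<forall>i. i \<notin> A \<longrightarrow> u $ i = 0) \<and> (\<Sum>i\<in>UNIV. u $ i) = 0}"

definition Harm :: "'n::finite set set \<Rightarrow> 'n set \<Rightarrow> (real ^ 'n) set" where
  "Harm E A = {v. v v* laplacian E \<in> W A}"

end

theory Submission
  imports Defs
begin

text \<open>
  For a connected edge set \<open>S\<close>, the space \<open>W (\<Union>S)\<close> is spanned by the differences
  \<open>e\<^sub>a - e\<^sub>b\<close> over the edges of \<open>S\<close>. A compatible \<open>U\<close> maps the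
  generators for \<open>S\<^sub>G\<close> onto those for \<open>S\<^sub>H\<close>, so it maps \<open>W A\<close> onto \<open>W C\<close>; since \<open>(u U) L\<^sub>G U\<^sup>T = u L\<^sub>H\<close> and \<open>U\<close> is invertible,
  \<open>u U\<close> is harmonic for \<open>G\<close> exactly when \<open>u\<close> is harmonic for \<open>H\<close>.
\<close>

text \<open>Since \<open>{a, b} = {b, a}\<close>, both orientations of every edge occur, so the set
  is closed under negation. This absorbs the free choice of end order in
  \<open>compatible\<close>.\<close>

definition edge_vectors :: "'n::finite set set \<Rightarrow> (real ^ 'n) set" where
  "edge_vectors S = {axis a 1 - axis b 1 | a b. {a, b} \<in> S}"

lemma subspace_W: "subspace (W A)"
  unfolding subspace_def W_def
  by (auto simp: sum.distrib simp flip: sum_distrib_left)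

text \<open>The edge vectors along a path from \<open>a\<close> to \<open>b\<close>
  telescope.\<close>

lemma axis_diff_in_span_edge_vectors:
  assumes "(a, b) \<in> (adj_rel S)\<^sup>*"
  shows "axis a 1 - axis b 1 \<in> span (edge_vectors S)"
  using assms
proof (induction rule: rtrancl_induct)
  case base
  show ?case by (simp add: span_zero)
next
  case (step b c)
  have "axis b 1 - axis c 1 \<in> edge_vectors S"
    using step.hyps(2) unfolding adj_rel_def edge_vectors_def by blast
  then have "axis b 1 - axis c 1 \<in> span (edge_vectors S)"
    by (rule span_base)
  from span_add[OF step.IH this] show ?case by simp
qed

lemma W_Union_eq_span_edge_vectors:
  assumes conn: "\<And>a b. a \<in> \<Union>S \<Longrightarrow> b \<in> \<Union>S \<Longrightarrow> (a, b) \<in> (adj_rel S)\<^sup>*"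
  shows "W (\<Union>S) = span (edge_vectors S)"
proof
  show "span (edge_vectors S) \<subseteq> W (\<Union>S)"
  proof (rule span_minimal[OF _ subspace_W])
    have "axis a 1 - axis b 1 \<in> W (\<Union>S)" if "{a, b} \<in> S" for a b :: 'a
      using that by (auto simp: W_def axis_def sum_subtractf)
    then show "edge_vectors S \<subseteq> W (\<Union>S)"
      unfolding edge_vectors_def by blast
  qed
  show "W (\<Union>S) \<subseteq> span (edge_vectors S)"
  proof
    fix u assume u: "u \<in> W (\<Union>S)"
    show "u \<in> span (edge_vectors S)"
    \<comment> \<open>Without vertices there is no root to choose, but then every entry of
      \<open>u\<close> vanishes.\<close>
    proof (cases "\<Union>S = {}")
      case True
      then have "u = 0" using u unfolding W_def by (simp only: empty_iff) (simp add: vec_eq_iff)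
      then show ?thesis by (simp add: span_zero)
    next
      case False
      then obtain r where r: "r \<in> \<Union>S" by blast
      \<comment> \<open>The entries of \<open>u\<close> sum to zero, so replacing each basis vector
        by its difference from the root \<open>r\<close> leaves the expansion of \<open>u\<close>
        unchanged.\<close>
      have "(\<Sum>i\<in>UNIV. u $ i *\<^sub>R axis r (1::real)) = 0"
        using u by (simp add: W_def flip: scaleR_left.sum)
      then have expand: "(\<Sum>i\<in>UNIV. u $ i *\<^sub>R (axis i 1 - axis r 1)) = u"
        using basis_expansion[of u] by (simp add: scaleR_diff_right sum_subtractf scalar_mult_eq_scaleR)
      have "u $ i *\<^sub>R (axis i 1 - axis r 1) \<in> span (edge_vectors S)" for i
      proof (cases "i \<in> \<Union>S")
        case True
        then show ?thesis
          by (intro span_scale axis_diff_in_span_edge_vectors conn r)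
      next
        case False
        then show ?thesis using u by (simp add: W_def span_zero)
      qed
      then have "(\<Sum>i\<in>UNIV. u $ i *\<^sub>R (axis i 1 - axis r 1)) \<in> span (edge_vectors S)"
        by (rule span_sum)
      then show ?thesis unfolding expand .
    qed
  qed
qed

lemma compatible_image_edge_vectors:
  assumes graph: "simple_graph E" and comp: "compatible E \<tau> U" and "S \<subseteq> E"
  shows "(*v) U ` edge_vectors S = edge_vectors (\<tau> ` S)"
proof
  have edge: "\<exists>c d. \<tau> {a, b} = {c, d} \<and> U *v (axis a 1 - axis b 1) = axis c 1 - axis d 1"
    if "{a, b} \<in> S" for a b
    using comp that \<open>S \<subseteq> E\<close> unfolding compatible_def by blast
  show "(*v) U ` edge_vectors S \<subseteq> edge_vectors (\<tau> ` S)"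
  proof
    fix y assume "y \<in> (*v) U ` edge_vectors S"
    then obtain a b where ab: "{a, b} \<in> S" and y: "y = U *v (axis a 1 - axis b 1)"
      unfolding edge_vectors_def by blast
    obtain c d where "\<tau> {a, b} = {c, d}" and "y = axis c 1 - axis d 1"
      using edge[OF ab] y by blast
    moreover from this have "{c, d} \<in> \<tau> ` S"
      using ab by (metis imageI)
    ultimately show "y \<in> edge_vectors (\<tau> ` S)"
      unfolding edge_vectors_def by blast
  qed
  show "edge_vectors (\<tau> ` S) \<subseteq> (*v) U ` edge_vectors S"
  proof
    fix y assume "y \<in> edge_vectors (\<tau> ` S)"
    then obtain c d e where y: "y = axis c 1 - axis d 1" and e: "e \<in> S" "\<tau> e = {c, d}"
      unfolding edge_vectors_def by auto
    \<comment> \<open>An edge must be displayed by its two ends before \<open>compatible\<close>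
      says anything about it.\<close>
    obtain a b where ab: "e = {a, b}"
      using graph \<open>S \<subseteq> E\<close> e(1) unfolding simple_graph_def by (meson card_2_iff subsetD)
    obtain c' d' where cd': "\<tau> {a, b} = {c', d'}"
      and U: "U *v (axis a 1 - axis b 1) = axis c' 1 - axis d' 1"
      using edge e(1) ab by blast
    have "{a, b} \<in> S" "{b, a} \<in> S"
      using e(1) unfolding ab by (simp_all add: insert_commute)
    then have mem: "axis a 1 - axis b 1 \<in> edge_vectors S" "axis b 1 - axis a 1 \<in> edge_vectors S"
      unfolding edge_vectors_def by blast+
    have swap: "U *v (axis b 1 - axis a 1) = axis d' 1 - axis c' 1"
      using U by (simp add: matrix_vector_mult_diff_distrib algebra_simps)
    \<comment> \<open>Compatibility may list the ends in the order opposite to that in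
      \<open>y\<close>; then \<open>y\<close> is the image of the reversed edge vector.\<close>
    have "c = c' \<and> d = d' \<or> c = d' \<and> d = c'"
      using cd' e(2) ab by (auto simp: doubleton_eq_iff)
    then show "y \<in> (*v) U ` edge_vectors S"
      using mem[THEN imageI[of _ _ "(*v) U"]] unfolding U swap y by auto
  qed
qed

theorem theorem2:
  fixes E_G E_H S_G S_H :: "'n::finite set set"
    and A C :: "'n set"
    and \<tau> :: "'n set \<Rightarrow> 'n set"
    and U :: "real ^ 'n ^ 'n"
    and m k :: nat
  assumes "connected_graph E_G" and "connected_graph E_H"
    and "card E_G = m" and "card E_H = m"
    and "two_isomorphism E_G E_H \<tau>"
    and "unimodular U"
    and "U ** laplacian E_G ** transpose U = laplacian E_H"
    and "compatible E_G \<tau> U"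
    and "S_G \<subseteq> E_G" and "k \<ge> 1" and "card S_G = k - 1"
    and "S_H = \<tau> ` S_G"
    and "subtree S_G" and "subtree S_H"
    and "A = \<Union>S_G" and "C = \<Union>S_H"
  shows "Harm E_G A = (\<lambda>u. u v* U) ` Harm E_H C"
proof -
  let ?LG = "laplacian E_G" and ?LH = "laplacian E_H"
  have conn: "W (\<Union>S) = span (edge_vectors S)" if "subtree S" for S :: "'n set set"
    using that W_Union_eq_span_edge_vectors[of S] unfolding subtree_def by blast
  have "simple_graph E_G"
    using assms(1) unfolding connected_graph_def by blast
  have "(*v) U ` W A = (*v) U ` span (edge_vectors S_G)"
    unfolding assms(15) conn[OF assms(13)] ..
  also have "\<dots> = span ((*v) U ` edge_vectors S_G)"
    by (simp add: linear_span_image)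
  also have "\<dots> = span (edge_vectors S_H)"
    unfolding compatible_image_edge_vectors[OF \<open>simple_graph E_G\<close> assms(8,9)] assms(12) ..
  also have "\<dots> = W C"
    unfolding assms(16) conn[OF assms(14)] ..
  finally have UW: "(*v) U ` W A = W C" .
  have "invertible U"
    using assms(6) unfolding unimodular_def by (auto simp: invertible_det_nz)
  then obtain V where VU: "V ** U = mat 1"
    unfolding invertible_def by blast
  then have "inj ((*v) U)"
    by (metis matrix_left_invertible_injective)
  \<comment> \<open>Applying \<open>U\<close> to a column is multiplying the row by
    \<open>transpose U\<close> on the right, which completes the product
    \<open>U ** ?LG ** transpose U\<close>.\<close>
  have shift: "U *v ((u v* U) v* ?LG) = u v* ?LH" for u
  proof -
    have "U *v ((u v* U) v* ?LG) = ((u v* U) v* ?LG) v* transpose U"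
      by simp
    then show ?thesis
      using assms(7) by (simp only: vector_matrix_mul_assoc)
  qed
  \<comment> \<open>By injectivity of \<open>U\<close>, a vector lies in \<open>W A\<close> exactly
    when its image lies in \<open>W C\<close>.\<close>
  have harm_iff: "u v* U \<in> Harm E_G A \<longleftrightarrow> u \<in> Harm E_H C" for u
    using inj_image_mem_iff[OF \<open>inj ((*v) U)\<close>, of "(u v* U) v* ?LG" "W A"]
    unfolding Harm_def UW shift by simp
  \<comment> \<open>The left inverse supplies the preimage \<open>v v* V\<close> needed for the
    inclusion from left to right.\<close>
  have V: "v = (v v* V) v* U" for v
    using VU by (simp add: vector_matrix_mul_assoc)
  show ?thesis
  proof
    show "(\<lambda>u. u v* U) ` Harm E_H C \<subseteq> Harm E_G A"
      using harm_iff by blast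
    show "Harm E_G A \<subseteq> (\<lambda>u. u v* U) ` Harm E_H C"
    proof
      fix v assume "v \<in> Harm E_G A"
      then have "v v* V \<in> Harm E_H C"
        using harm_iff[of "v v* V"] unfolding V[symmetric] by simp
      then show "v \<in> (\<lambda>u. u v* U) ` Harm E_H C"
        using V[of v] by (rule rev_image_eqI)
    qed
  qed
qed

end
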